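(* Let $E_1,\dots,E_m$ be Banach spaces, let $\mathfrak{R}$ be the set of all $m$-bounded sequences in $E_1\times\cdots\times E_m$, and let $\sim$ be a relation from $\mathfrak{R}$ to $E_1\times\cdots\times E_m$, that is, an arbitrary subset of $\mathfrak{R}\times(E_1\times\cdots\times E_m)$. For every Banach space $F$, the set of multilinear operators $A\in\mathcal{L}(E_1,\dots,E_m;F)$ such that $A(x_1^n,\dots,x_m^n)\longrightarrow A(x_1,\dots,x_m)$ in $F$ whenever the sequence $((x_1^n,\dots,x_m^n))_n$ is $m$-bounded and $((x_1^n,\dots,x_m^n))_n\sim(x_1,\dots,x_m)$ is a closed subspace of $\mathcal{L}(E_1,\dots,E_m;F)$.
   Context: A sequence $((x_1^n,\dots,x_m^n))_n$ in $E_1\times\cdots\times E_m$ is $m$-bounded if $\sup_n\|x_1^n\|\cdots\|x_m^n\|<\infty$. One writes $((x_1^n,\dots,x_m^n))_n\sim(x_1,\dots,x_m)$ when the pair $(((x_1^n,\dots,x_m^n))_n,(x_1,\dots,x_m))$ belongs to $\sim$. $\mathcal{L}(E_1,\dots,E_m;F)$ is the Banach space of continuous $m$-linear operators with the usual sup norm over unit balls. *)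

theory Defs
  imports "HOL-Analysis.Analysis" "HOL-Algebra.Module"
begin

text \<open>
  The \<open>m\<close> spaces are pairwise unrelated, and \<open>m\<close> is a variable, so Banach spaces are rendered as
  structures with an explicit carrier: modules of HOL-Algebra equipped with a norm.
  A common element type for \<open>E\<^sub>1, \<dots>, E\<^sub>m\<close> is no restriction: carriers of
  different types can be put side by side in a sum type.

  The scalars are a type of class \<open>real_normed_field\<close>. As the norm of such a field is
  multiplicative, the instances are, up to isomorphism, exactly the real and the complex numbers.
\<close>

definition scalars :: "'k::real_normed_field ring" where
  "scalars = \<lparr>carrier = UNIV, monoid.mult = (*), one = 1, zero = 0, add = (+)\<rparr>"

text \<open>The fields \<open>mult\<close> and \<open>one\<close> inherited from the record of modules are never used.\<close>

record ('k, 'a) normed_space = "('k, 'a) module" +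
  vnorm :: "'a \<Rightarrow> real"

locale normed_space = module scalars N
  for N :: "('k::real_normed_field, 'a, 'c) normed_space_scheme" (structure) +
  assumes vnorm_nonneg: "x \<in> carrier N \<Longrightarrow> 0 \<le> vnorm N x"
    and vnorm_eq_0: "x \<in> carrier N \<Longrightarrow> vnorm N x = 0 \<longleftrightarrow> x = \<zero>"
    and vnorm_smult: "x \<in> carrier N \<Longrightarrow> vnorm N (c \<odot> x) = norm c * vnorm N x"
    and vnorm_triangle:
      "x \<in> carrier N \<Longrightarrow> y \<in> carrier N \<Longrightarrow> vnorm N (x \<oplus> y) \<le> vnorm N x + vnorm N y"

text \<open>The library asks a distance to be nonnegative and symmetric off the carrier, too;
  hence the value 0 there.\<close>

definition vdist :: "('k, 'a, 'c) normed_space_scheme \<Rightarrow> 'a \<Rightarrow> 'a \<Rightarrow> real" where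
  "vdist N x y =
     (if x \<in> carrier N \<and> y \<in> carrier N then vnorm N (x \<ominus>\<^bsub>N\<^esub> y) else 0)"

definition norm_topology :: "('k, 'a, 'c) normed_space_scheme \<Rightarrow> 'a topology" where
  "norm_topology N = Metric_space.mtopology (carrier N) (vdist N)"

locale banach_space = normed_space N
  for N :: "('k::real_normed_field, 'a, 'c) normed_space_scheme" (structure) +
  assumes complete: "Metric_space.mcomplete (carrier N) (vdist N)"

definition closed_subspace ::
  "'a set \<Rightarrow> ('k::real_normed_field, 'a, 'c) normed_space_scheme \<Rightarrow> bool" where
  "closed_subspace S N \<longleftrightarrow> submodule S scalars N \<and> closedin (norm_topology N) S"

lemma (in normed_space) vnorm_minus:
  assumes "x \<in> carrier N"
  shows "vnorm N (\<ominus> x) = vnorm N x"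
proof -
  have "\<ominus>\<^bsub>scalars\<^esub> (1::'k) = - 1"
    by (rule R.minus_equality) (simp_all add: scalars_def)
  moreover have "\<ominus> x = (\<ominus>\<^bsub>scalars\<^esub> (1::'k)) \<odot> x"
    using assms smult_l_minus[of 1 x] smult_one[of x] by (simp add: scalars_def)
  ultimately show ?thesis
    using vnorm_smult[OF assms, of "- 1"] by simp
qed

lemma (in normed_space) Metric_space_vdist: "Metric_space (carrier N) (vdist N)"
proof
  show "0 \<le> vdist N x y" for x y
    by (simp add: vdist_def vnorm_nonneg)
  show "vdist N x y = vdist N y x" for x y
  proof (cases "x \<in> carrier N \<and> y \<in> carrier N")
    case True
    then have "\<ominus> (x \<ominus> y) = y \<ominus> x"
      by (simp add: M.minus_eq M.minus_add M.a_comm)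
    with True show ?thesis
      using vnorm_minus[of "x \<ominus> y"] by (simp add: vdist_def)
  qed (auto simp: vdist_def)
  show "vdist N x y = 0 \<longleftrightarrow> x = y" if "x \<in> carrier N" "y \<in> carrier N" for x y
  proof -
    have "x = (x \<ominus> y) \<oplus> y"
      using that by (simp add: M.minus_eq M.a_assoc M.l_neg)
    then have "x \<ominus> y = \<zero> \<longleftrightarrow> x = y"
      using that by (metis M.l_zero M.minus_eq M.r_neg)
    then show ?thesis
      using that by (simp add: vdist_def vnorm_eq_0)
  qed
  show "vdist N x z \<le> vdist N x y + vdist N y z"
    if "x \<in> carrier N" "y \<in> carrier N" "z \<in> carrier N" for x y z
  proof -
    have "x \<ominus> z = (x \<ominus> y) \<oplus> (y \<ominus> z)"
      using that by (simp add: M.minus_eq M.a_assoc M.r_neg1)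
    then show ?thesis
      using that vnorm_triangle[of "x \<ominus> y" "y \<ominus> z"] by (simp add: vdist_def)
  qed
qed

definition tuples :: "nat \<Rightarrow> (nat \<Rightarrow> ('k, 'a) normed_space) \<Rightarrow> (nat \<Rightarrow> 'a) set" where
  "tuples m E = (\<Pi>\<^sub>E i\<in>{1..m}. carrier (E i))"

definition unit_balls :: "nat \<Rightarrow> (nat \<Rightarrow> ('k, 'a) normed_space) \<Rightarrow> (nat \<Rightarrow> 'a) set" where
  "unit_balls m E = (\<Pi>\<^sub>E i\<in>{1..m}. {u \<in> carrier (E i). vnorm (E i) u \<le> 1})"

definition multilinear ::
  "nat \<Rightarrow> (nat \<Rightarrow> ('k, 'a) normed_space) \<Rightarrow> ('k, 'b) normed_space \<Rightarrow> ((nat \<Rightarrow> 'a) \<Rightarrow> 'b) \<Rightarrow> bool"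
where
  "multilinear m E F A \<longleftrightarrow>
     A \<in> tuples m E \<rightarrow> carrier F \<and>
     (\<forall>x\<in>tuples m E. \<forall>i\<in>{1..m}. \<forall>u\<in>carrier (E i). \<forall>v\<in>carrier (E i).
        A (x(i := u \<oplus>\<^bsub>E i\<^esub> v)) = A (x(i := u)) \<oplus>\<^bsub>F\<^esub> A (x(i := v))) \<and>
     (\<forall>x\<in>tuples m E. \<forall>i\<in>{1..m}. \<forall>u\<in>carrier (E i). \<forall>c.
        A (x(i := c \<odot>\<^bsub>E i\<^esub> u)) = c \<odot>\<^bsub>F\<^esub> A (x(i := u)))"

text \<open>\<open>\<L>(E\<^sub>1, \<dots>, E\<^sub>m; F)\<close>; operators are functions on tuples, extensional so that
  each is represented once.\<close>

definition cont_multilinear ::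
  "nat \<Rightarrow> (nat \<Rightarrow> ('k, 'a) normed_space) \<Rightarrow> ('k, 'b) normed_space
     \<Rightarrow> ('k, (nat \<Rightarrow> 'a) \<Rightarrow> 'b) normed_space"
where
  "cont_multilinear m E F =
     \<lparr>carrier = {A \<in> extensional (tuples m E). multilinear m E F A \<and>
        continuous_map (product_topology (\<lambda>i. norm_topology (E i)) {1..m}) (norm_topology F) A},
      monoid.mult = undefined, one = undefined,
      zero = (\<lambda>x\<in>tuples m E. \<zero>\<^bsub>F\<^esub>),
      add = (\<lambda>A B. \<lambda>x\<in>tuples m E. A x \<oplus>\<^bsub>F\<^esub> B x),
      smult = (\<lambda>c A. \<lambda>x\<in>tuples m E. c \<odot>\<^bsub>F\<^esub> A x),
      vnorm = (\<lambda>A. SUP x\<in>unit_balls m E. vnorm F (A x))\<rparr>"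

text \<open>For a sequence \<open>xs\<close> of tuples, \<open>xs n i\<close> is \<open>x\<^sub>i\<^sup>n\<close>.\<close>

definition m_bounded_seqs ::
  "nat \<Rightarrow> (nat \<Rightarrow> ('k, 'a) normed_space) \<Rightarrow> (nat \<Rightarrow> nat \<Rightarrow> 'a) set"
where
  "m_bounded_seqs m E =
     {xs. (\<forall>n. xs n \<in> tuples m E) \<and>
          bdd_above (range (\<lambda>n. \<Prod>i=1..m. vnorm (E i) (xs n i)))}"

end

theory Submission
  imports Defs
begin

text \<open>
  The set in question is a subspace because limits in \<open>F\<close> are compatible with sums and scalar
  multiples (\<open>limitin_add\<close>, \<open>limitin_smult\<close>), while addition and scalar multiplication of
  operators are pointwise.

  It is closed by the usual argument for uniform limits. Suppose that \<open>A\<close> can be approximated in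
  operator norm by operators \<open>B\<close> of the set, and that \<open>xs\<close> is related to \<open>x\<close>. An operator
  of norm \<open>C\<close> satisfies
  \<open>\<parallel>A(x\<^sub>1, \<dots>, x\<^sub>m)\<parallel> \<le> C \<parallel>x\<^sub>1\<parallel> \<cdots> \<parallel>x\<^sub>m\<parallel>\<close> (\<open>operator_bound\<close>), and the
  products of norms along an \<open>m\<close>-bounded sequence stay below some \<open>K\<close>, which may be taken to
  dominate the product for \<open>x\<close> as well. So \<open>\<parallel>A - B\<parallel> K\<close> bounds the difference of \<open>A\<close> and \<open>B\<close>
  at \<open>x\<close> and at all \<open>xs n\<close> at once, and
  \<open>\<parallel>A (xs n) - A x\<parallel> \<le> 2 \<parallel>A - B\<parallel> K + \<parallel>B (xs n) - B x\<parallel>\<close> (\<open>vnorm_diff_le\<close>), which is eventually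
  small. It is here that \<open>m\<close>-boundedness takes the place of boundedness in each coordinate.

  Both halves presuppose that the continuous multilinear operators form a normed space
  (\<open>normed_space_L\<close>). The substantial point is that the supremum defining the operator norm
  ranges over a bounded set (\<open>bdd_above_unit_balls\<close>): in HOL the supremum of an unbounded set of
  reals carries no information. As for linear operators, boundedness follows from continuity at
  the origin by rescaling, here in every coordinate separately (\<open>multilinear_scale\<close>).
\<close>

section \<open>Scalars and limits in a normed space\<close>

lemma scalars_simps [simp]:
  "carrier scalars = UNIV" "x \<otimes>\<^bsub>scalars\<^esub> y = x * y" "\<one>\<^bsub>scalars\<^esub> = 1"
  "\<zero>\<^bsub>scalars\<^esub> = 0" "x \<oplus>\<^bsub>scalars\<^esub> y = x + y"
  by (simp_all add: scalars_def)

context normed_space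
begin

lemma diff_closed [simp]: "x \<in> carrier N \<Longrightarrow> y \<in> carrier N \<Longrightarrow> x \<ominus> y \<in> carrier N"
  by (simp add: M.minus_eq)

lemma vnorm_zero [simp]: "vnorm N \<zero> = 0"
  by (simp add: vnorm_eq_0)

lemma minus_conv_smult: "x \<in> carrier N \<Longrightarrow> \<ominus> x = (-1) \<odot> x"
proof -
  assume x: "x \<in> carrier N"
  have "((-1) \<odot> x) \<oplus> x = (-1 + 1) \<odot> x"
    using smult_l_distr[of "-1" 1 x] smult_one[OF x] x by simp
  also have "\<dots> = \<zero>"
    using smult_l_null[OF x] by simp
  finally show "\<ominus> x = (-1) \<odot> x"
    using x smult_closed by (intro M.minus_equality) auto
qed

lemma add_interchange:
  assumes "a \<in> carrier N" "b \<in> carrier N" "c \<in> carrier N" "d \<in> carrier N"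
  shows "(a \<oplus> b) \<oplus> (c \<oplus> d) = (a \<oplus> c) \<oplus> (b \<oplus> d)"
  using assms by (simp add: M.a_assoc M.a_lcomm[of b c d])

lemma limitin_norm_topology:
  "limitin (norm_topology N) f l G \<longleftrightarrow>
     l \<in> carrier N \<and> (\<forall>\<epsilon>>0. \<forall>\<^sub>F x in G. f x \<in> carrier N \<and> vnorm N (f x \<ominus> l) < \<epsilon>)"
proof -
  interpret Metric_space "carrier N" "vdist N"
    by (rule Metric_space_vdist)
  show ?thesis
    unfolding norm_topology_def limitin_metric
    by (auto simp: vdist_def elim!: eventually_mono)
qed

lemma limitin_norm_topologyD:
  assumes "limitin (norm_topology N) f l G"
  shows "l \<in> carrier N"
    and "\<epsilon> > 0 \<Longrightarrow> \<forall>\<^sub>F x in G. f x \<in> carrier N \<and> vnorm N (f x \<ominus> l) < \<epsilon>"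
  using assms by (simp_all add: limitin_norm_topology)

lemma topspace_norm_topology [simp]: "topspace (norm_topology N) = carrier N"
  using Metric_space.topspace_mtopology[OF Metric_space_vdist]
  by (simp add: norm_topology_def)

lemma limitin_add:
  assumes "limitin (norm_topology N) f a G" and "limitin (norm_topology N) g b G"
  shows "limitin (norm_topology N) (\<lambda>x. f x \<oplus> g x) (a \<oplus> b) G"
  unfolding limitin_norm_topology
proof (intro conjI allI impI)
  have ab: "a \<in> carrier N" "b \<in> carrier N"
    using limitin_norm_topologyD(1) assms by blast+
  then show "a \<oplus> b \<in> carrier N"
    by simp
  fix \<epsilon> :: real
  assume "\<epsilon> > 0"
  then have "\<forall>\<^sub>F x in G. f x \<in> carrier N \<and> vnorm N (f x \<ominus> a) < \<epsilon> / 2"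
    and "\<forall>\<^sub>F x in G. g x \<in> carrier N \<and> vnorm N (g x \<ominus> b) < \<epsilon> / 2"
    using limitin_norm_topologyD(2) assms half_gt_zero by blast+
  then show "\<forall>\<^sub>F x in G. f x \<oplus> g x \<in> carrier N \<and> vnorm N ((f x \<oplus> g x) \<ominus> (a \<oplus> b)) < \<epsilon>"
  proof eventually_elim
    case (elim x)
    have "(f x \<oplus> g x) \<ominus> (a \<oplus> b) = (f x \<ominus> a) \<oplus> (g x \<ominus> b)"
      unfolding M.minus_eq using elim ab
      by (simp add: M.minus_add add_interchange[of "f x" "g x" "\<ominus> a" "\<ominus> b"])
    then show ?case
      using elim ab vnorm_triangle[of "f x \<ominus> a" "g x \<ominus> b"] by simp
  qed
qed

lemma limitin_smult:
  assumes "limitin (norm_topology N) f a G"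
  shows "limitin (norm_topology N) (\<lambda>x. c \<odot> f x) (c \<odot> a) G"
  unfolding limitin_norm_topology
proof (intro conjI allI impI)
  have a: "a \<in> carrier N"
    using limitin_norm_topologyD(1) assms by blast
  then show "c \<odot> a \<in> carrier N"
    by simp
  fix \<epsilon> :: real
  assume \<epsilon>: "\<epsilon> > 0"
  (* Division by norm c + 1 rather than norm c covers c = 0. *)
  have pos: "0 < norm c + 1"
    using norm_ge_zero[of c] by linarith
  then have "\<forall>\<^sub>F x in G. f x \<in> carrier N \<and> vnorm N (f x \<ominus> a) < \<epsilon> / (norm c + 1)"
    using limitin_norm_topologyD(2)[OF assms] divide_pos_pos[OF \<epsilon>] by blast
  then show "\<forall>\<^sub>F x in G. c \<odot> f x \<in> carrier N \<and> vnorm N ((c \<odot> f x) \<ominus> (c \<odot> a)) < \<epsilon>"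
  proof eventually_elim
    case (elim x)
    have "(c \<odot> f x) \<ominus> (c \<odot> a) = c \<odot> (f x \<ominus> a)"
      using elim a smult_assoc1[of "-1" c a] smult_assoc1[of c "-1" a]
      by (simp add: M.minus_eq minus_conv_smult smult_r_distr)
    then have "vnorm N ((c \<odot> f x) \<ominus> (c \<odot> a)) = norm c * vnorm N (f x \<ominus> a)"
      using elim a by (simp add: vnorm_smult)
    also have "\<dots> \<le> (norm c + 1) * vnorm N (f x \<ominus> a)"
      using elim a by (intro mult_right_mono) (auto simp: vnorm_nonneg)
    also have "\<dots> < \<epsilon>"
      using elim pos by (simp add: pos_less_divide_eq mult.commute)
    finally show ?case
      using elim by simp
  qed
qed

lemma limitin_const_norm_topology:
  "a \<in> carrier N \<Longrightarrow> limitin (norm_topology N) (\<lambda>x. a) a G"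
  by (simp add: limitin_const_iff)

end

section \<open>The normed space of continuous multilinear operators\<close>

locale multilinear_spaces =
  fixes m :: nat
    and E :: "nat \<Rightarrow> ('k::real_normed_field, 'a) normed_space"
    and F :: "('k, 'b) normed_space"
  assumes normed_space_E: "i \<in> {1..m} \<Longrightarrow> normed_space (E i)"
    and normed_space_F: "normed_space F"
begin

sublocale F: normed_space F
  by (rule normed_space_F)

abbreviation "T \<equiv> tuples m E"
abbreviation "L \<equiv> cont_multilinear m E F"
abbreviation "X \<equiv> product_topology (\<lambda>i. norm_topology (E i)) {1..m}"

lemma tuples_upd: "x \<in> T \<Longrightarrow> i \<in> {1..m} \<Longrightarrow> u \<in> carrier (E i) \<Longrightarrow> x(i := u) \<in> T"
  by (auto simp: tuples_def PiE_iff extensional_def)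

lemma tuples_nth: "x \<in> T \<Longrightarrow> i \<in> {1..m} \<Longrightarrow> x i \<in> carrier (E i)"
  by (auto simp: tuples_def)

lemma topspace_X: "topspace X = T"
  unfolding tuples_def topspace_product_topology
  by (intro PiE_cong normed_space.topspace_norm_topology normed_space_E)

lemma multilinear_closed: "multilinear m E F A \<Longrightarrow> x \<in> T \<Longrightarrow> A x \<in> carrier F"
  by (auto simp: multilinear_def)

lemma carrier_closed: "A \<in> carrier L \<Longrightarrow> x \<in> T \<Longrightarrow> A x \<in> carrier F"
  by (auto simp: cont_multilinear_def multilinear_def)

lemma L_simps:
  "x \<in> T \<Longrightarrow> (A \<oplus>\<^bsub>L\<^esub> B) x = A x \<oplus>\<^bsub>F\<^esub> B x"
  "x \<in> T \<Longrightarrow> (c \<odot>\<^bsub>L\<^esub> A) x = c \<odot>\<^bsub>F\<^esub> A x"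
  "x \<in> T \<Longrightarrow> \<zero>\<^bsub>L\<^esub> x = \<zero>\<^bsub>F\<^esub>"
  by (simp_all add: cont_multilinear_def)

lemma L_extensional: "A \<in> carrier L \<Longrightarrow> A \<in> extensional T"
  "A \<oplus>\<^bsub>L\<^esub> B \<in> extensional T" "c \<odot>\<^bsub>L\<^esub> A \<in> extensional T" "\<zero>\<^bsub>L\<^esub> \<in> extensional T"
  by (simp_all add: cont_multilinear_def)

lemmas L_eqI = extensionalityI[where A = T]

text \<open>Expressing continuity as a limit at every point makes the two ways in which limits are
  used, continuity of operators and convergence along the relation, instances of the same
  limit laws.\<close>

lemma carrier_L_iff:
  "A \<in> carrier L \<longleftrightarrow> A \<in> extensional T \<and> multilinear m E F A \<and>
     (\<forall>x\<in>T. limitin (norm_topology F) A (A x) (atin X x))"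
  unfolding cont_multilinear_def continuous_map_atin topspace_X by simp

lemma limitin_atin_cong:
  assumes "limitin (norm_topology F) f l (atin X x)" and "\<And>y. y \<in> T \<Longrightarrow> f y = g y"
  shows "limitin (norm_topology F) g l (atin X x)"
proof (rule limitin_transform_eventually[OF _ assms(1)])
  show "\<forall>\<^sub>F y in atin X x. f y = g y"
    unfolding eventually_atin topspace_X
    using assms(2) openin_topspace[of X, unfolded topspace_X] by blast
qed

lemma multilinearI:
  assumes "\<And>x. x \<in> T \<Longrightarrow> A x \<in> carrier F"
    and "\<And>x i u v. x \<in> T \<Longrightarrow> i \<in> {1..m} \<Longrightarrow> u \<in> carrier (E i) \<Longrightarrow> v \<in> carrier (E i) \<Longrightarrow>
      A (x(i := u \<oplus>\<^bsub>E i\<^esub> v)) = A (x(i := u)) \<oplus>\<^bsub>F\<^esub> A (x(i := v))"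
    and "\<And>x i u c. x \<in> T \<Longrightarrow> i \<in> {1..m} \<Longrightarrow> u \<in> carrier (E i) \<Longrightarrow>
      A (x(i := c \<odot>\<^bsub>E i\<^esub> u)) = c \<odot>\<^bsub>F\<^esub> A (x(i := u))"
  shows "multilinear m E F A"
  using assms by (auto simp: multilinear_def)

lemma multilinear_add:
  "multilinear m E F A \<Longrightarrow> x \<in> T \<Longrightarrow> i \<in> {1..m} \<Longrightarrow> u \<in> carrier (E i) \<Longrightarrow> v \<in> carrier (E i) \<Longrightarrow>
     A (x(i := u \<oplus>\<^bsub>E i\<^esub> v)) = A (x(i := u)) \<oplus>\<^bsub>F\<^esub> A (x(i := v))"
  by (auto simp: multilinear_def)

lemma multilinear_smult:
  "multilinear m E F A \<Longrightarrow> x \<in> T \<Longrightarrow> i \<in> {1..m} \<Longrightarrow> u \<in> carrier (E i) \<Longrightarrow>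
     A (x(i := c \<odot>\<^bsub>E i\<^esub> u)) = c \<odot>\<^bsub>F\<^esub> A (x(i := u))"
  by (auto simp: multilinear_def)

lemma E_add_closed: "i \<in> {1..m} \<Longrightarrow> u \<in> carrier (E i) \<Longrightarrow> v \<in> carrier (E i) \<Longrightarrow>
    u \<oplus>\<^bsub>E i\<^esub> v \<in> carrier (E i)"
proof -
  assume i: "i \<in> {1..m}" and "u \<in> carrier (E i)" "v \<in> carrier (E i)"
  interpret Ei: normed_space "E i" by (rule normed_space_E[OF i])
  show ?thesis by (rule Ei.M.a_closed) fact+
qed

lemma E_smult_closed: "i \<in> {1..m} \<Longrightarrow> u \<in> carrier (E i) \<Longrightarrow> c \<odot>\<^bsub>E i\<^esub> u \<in> carrier (E i)"
proof -
  assume i: "i \<in> {1..m}" and "u \<in> carrier (E i)"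
  interpret Ei: normed_space "E i" by (rule normed_space_E[OF i])
  show ?thesis by (rule Ei.smult_closed) (simp, fact)
qed

lemma add_L_closed:
  assumes A: "A \<in> carrier L" and B: "B \<in> carrier L"
  shows "A \<oplus>\<^bsub>L\<^esub> B \<in> carrier L"
  unfolding carrier_L_iff
proof (intro conjI ballI)
  have mA: "multilinear m E F A" and mB: "multilinear m E F B"
    using A B by (auto simp: carrier_L_iff)
  note [simp] = multilinear_closed[OF mA] multilinear_closed[OF mB] tuples_upd L_simps
    E_add_closed E_smult_closed
  show "multilinear m E F (A \<oplus>\<^bsub>L\<^esub> B)"
    by (rule multilinearI)
      (simp_all add: multilinear_add[OF mA] multilinear_add[OF mB]
        multilinear_smult[OF mA] multilinear_smult[OF mB] F.add_interchange F.smult_r_distr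
        del: fun_upd_apply)
  fix x
  assume x: "x \<in> T"
  have "limitin (norm_topology F) (\<lambda>y. A y \<oplus>\<^bsub>F\<^esub> B y) (A x \<oplus>\<^bsub>F\<^esub> B x) (atin X x)"
    using A B x by (intro F.limitin_add) (auto simp: carrier_L_iff)
  then show "limitin (norm_topology F) (A \<oplus>\<^bsub>L\<^esub> B) ((A \<oplus>\<^bsub>L\<^esub> B) x) (atin X x)"
    unfolding L_simps(1)[OF x] by (rule limitin_atin_cong) simp
qed (rule L_extensional)

lemma smult_L_closed:
  assumes A: "A \<in> carrier L"
  shows "c \<odot>\<^bsub>L\<^esub> A \<in> carrier L"
  unfolding carrier_L_iff
proof (intro conjI ballI)
  have mA: "multilinear m E F A"
    using A by (auto simp: carrier_L_iff)
  note [simp] = multilinear_closed[OF mA] tuples_upd L_simps E_add_closed E_smult_closed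
  have "c \<odot>\<^bsub>F\<^esub> (d \<odot>\<^bsub>F\<^esub> y) = d \<odot>\<^bsub>F\<^esub> (c \<odot>\<^bsub>F\<^esub> y)" if "y \<in> carrier F" for d y
    using F.smult_assoc1[of c d y] F.smult_assoc1[of d c y] that by (simp add: mult.commute)
  then show "multilinear m E F (c \<odot>\<^bsub>L\<^esub> A)"
    by (intro multilinearI)
      (simp_all add: multilinear_add[OF mA] multilinear_smult[OF mA] F.smult_r_distr)
  fix x
  assume x: "x \<in> T"
  have "limitin (norm_topology F) (\<lambda>y. c \<odot>\<^bsub>F\<^esub> A y) (c \<odot>\<^bsub>F\<^esub> A x) (atin X x)"
    using A x by (intro F.limitin_smult) (auto simp: carrier_L_iff)
  then show "limitin (norm_topology F) (c \<odot>\<^bsub>L\<^esub> A) ((c \<odot>\<^bsub>L\<^esub> A) x) (atin X x)"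
    unfolding L_simps(2)[OF x] by (rule limitin_atin_cong) simp
qed (rule L_extensional)

lemma zero_L_closed: "\<zero>\<^bsub>L\<^esub> \<in> carrier L"
  unfolding carrier_L_iff
proof (intro conjI ballI)
  show "multilinear m E F \<zero>\<^bsub>L\<^esub>"
    by (rule multilinearI) (simp_all add: L_simps tuples_upd E_add_closed E_smult_closed)
  fix x
  assume x: "x \<in> T"
  have "limitin (norm_topology F) (\<lambda>y. \<zero>\<^bsub>F\<^esub>) \<zero>\<^bsub>F\<^esub> (atin X x)"
    by (rule F.limitin_const_norm_topology) simp
  then show "limitin (norm_topology F) \<zero>\<^bsub>L\<^esub> (\<zero>\<^bsub>L\<^esub> x) (atin X x)"
    unfolding L_simps(3)[OF x] by (rule limitin_atin_cong) (simp add: L_simps)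
qed (rule L_extensional)

lemma module_L: "module scalars L"
proof (rule moduleI)
  note [simp] = add_L_closed smult_L_closed zero_L_closed carrier_closed L_simps
  show "cring (scalars :: 'k ring)"
    by (rule module.axioms(1)[OF normed_space.axioms(1)[OF normed_space_F]])
  show "abelian_group L"
  proof (rule abelian_groupI)
    fix A
    assume A: "A \<in> carrier L"
    have "(-1) \<odot>\<^bsub>L\<^esub> A \<oplus>\<^bsub>L\<^esub> A = \<zero>\<^bsub>L\<^esub>"
      using A by (intro L_eqI)
        (auto simp: L_extensional F.minus_conv_smult[symmetric] F.M.l_neg)
    then show "\<exists>B\<in>carrier L. B \<oplus>\<^bsub>L\<^esub> A = \<zero>\<^bsub>L\<^esub>"
      using A smult_L_closed by blast
    show "A \<oplus>\<^bsub>L\<^esub> B \<oplus>\<^bsub>L\<^esub> C = A \<oplus>\<^bsub>L\<^esub> (B \<oplus>\<^bsub>L\<^esub> C)"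
      if "B \<in> carrier L" "C \<in> carrier L" for B C
      by (intro L_eqI) (use A that in \<open>simp_all add: L_extensional F.M.a_assoc\<close>)
    show "A \<oplus>\<^bsub>L\<^esub> B = B \<oplus>\<^bsub>L\<^esub> A" if "B \<in> carrier L" for B
      by (intro L_eqI) (use A that in \<open>simp_all add: L_extensional F.M.a_comm\<close>)
    show "\<zero>\<^bsub>L\<^esub> \<oplus>\<^bsub>L\<^esub> A = A"
      by (intro L_eqI) (use A in \<open>simp_all add: L_extensional\<close>)
  qed simp_all
  fix c d :: 'k and A
  assume A: "A \<in> carrier L"
  show "(c \<oplus>\<^bsub>scalars\<^esub> d) \<odot>\<^bsub>L\<^esub> A = c \<odot>\<^bsub>L\<^esub> A \<oplus>\<^bsub>L\<^esub> d \<odot>\<^bsub>L\<^esub> A"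
    by (intro L_eqI) (use A F.smult_l_distr[of c d] in \<open>simp_all add: L_extensional\<close>)
  show "c \<odot>\<^bsub>L\<^esub> (A \<oplus>\<^bsub>L\<^esub> B) = c \<odot>\<^bsub>L\<^esub> A \<oplus>\<^bsub>L\<^esub> c \<odot>\<^bsub>L\<^esub> B" if "B \<in> carrier L" for B
    by (intro L_eqI) (use A that in \<open>simp_all add: L_extensional F.smult_r_distr\<close>)
  show "(c \<otimes>\<^bsub>scalars\<^esub> d) \<odot>\<^bsub>L\<^esub> A = c \<odot>\<^bsub>L\<^esub> (d \<odot>\<^bsub>L\<^esub> A)"
    by (intro L_eqI) (use A F.smult_assoc1[of c d] in \<open>simp_all add: L_extensional\<close>)
  show "\<one>\<^bsub>scalars\<^esub> \<odot>\<^bsub>L\<^esub> A = A"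
    by (intro L_eqI) (use A F.smult_one in \<open>simp_all add: L_extensional\<close>)
qed (rule smult_L_closed)

subsection \<open>Boundedness\<close>

text \<open>The set \<open>J\<close> of coordinates already rescaled is the induction variable; the uses below have
  \<open>J = {1..m}\<close>. Membership in \<open>T\<close> is proved along, since multilinearity speaks only about tuples
  of \<open>T\<close>.\<close>

lemma multilinear_scale:
  assumes A: "multilinear m E F A" and x: "x \<in> T" and J: "J \<subseteq> {1..m}"
  shows "(\<lambda>i. if i \<in> J then c i \<odot>\<^bsub>E i\<^esub> x i else x i) \<in> T \<and>
         A (\<lambda>i. if i \<in> J then c i \<odot>\<^bsub>E i\<^esub> x i else x i) = (\<Prod>i\<in>J. c i) \<odot>\<^bsub>F\<^esub> A x"
proof -
  have "finite J"
    using J finite_subset by blast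
  then show ?thesis
    using J
  proof (induction J rule: finite_induct)
    case empty
    then show ?case
      using A x F.smult_one[of "A x"] by (simp add: multilinear_closed)
  next
    case (insert j J)
    let ?y = "\<lambda>i. if i \<in> J then c i \<odot>\<^bsub>E i\<^esub> x i else x i"
    have y: "?y \<in> T" "A ?y = (\<Prod>i\<in>J. c i) \<odot>\<^bsub>F\<^esub> A x" and j: "j \<in> {1..m}"
      using insert by auto
    have xj: "x j \<in> carrier (E j)"
      using x j by (rule tuples_nth)
    have eq: "(\<lambda>i. if i \<in> insert j J then c i \<odot>\<^bsub>E i\<^esub> x i else x i) = ?y(j := c j \<odot>\<^bsub>E j\<^esub> x j)"
      by auto
    have "?y(j := x j) = ?y"
      using insert.hyps by auto
    then have "A (?y(j := c j \<odot>\<^bsub>E j\<^esub> x j)) = c j \<odot>\<^bsub>F\<^esub> A ?y"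
      using multilinear_smult[OF A y(1) j xj, of "c j"] by simp
    also have "\<dots> = (\<Prod>i\<in>insert j J. c i) \<odot>\<^bsub>F\<^esub> A x"
      using F.smult_assoc1[of "c j" "\<Prod>i\<in>J. c i" "A x"] insert.hyps y(2)
        multilinear_closed[OF A x] by simp
    finally show ?case
      unfolding eq using tuples_upd[OF y(1) j E_smult_closed[OF j xj]] by simp
  qed
qed

text \<open>A tuple with a null coordinate cannot be normalised to the unit balls, so the operator bound
  treats it separately.\<close>

lemma multilinear_eq_zero:
  assumes A: "multilinear m E F A" and x: "x \<in> T" and i: "i \<in> {1..m}" and "vnorm (E i) (x i) = 0"
  shows "A x = \<zero>\<^bsub>F\<^esub>"
proof -
  interpret Ei: normed_space "E i" by (rule normed_space_E[OF i])
  have xi: "x i \<in> carrier (E i)"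
    using x i by (rule tuples_nth)
  then have "x i = 0 \<odot>\<^bsub>E i\<^esub> x i"
    using assms(4) Ei.vnorm_eq_0 Ei.smult_l_null[OF xi] by simp
  then have "A x = 0 \<odot>\<^bsub>F\<^esub> A x"
    using multilinear_smult[OF A x i xi, of 0] by (metis fun_upd_triv)
  then show ?thesis
    using F.smult_l_null[OF multilinear_closed[OF A x]] by simp
qed

lemma unit_balls_tuples: "x \<in> unit_balls m E \<Longrightarrow> x \<in> T"
  by (auto simp: unit_balls_def tuples_def)

definition origin :: "nat \<Rightarrow> 'a" where
  "origin = (\<lambda>i\<in>{1..m}. \<zero>\<^bsub>E i\<^esub>)"

lemma zero_E_closed: "i \<in> {1..m} \<Longrightarrow> \<zero>\<^bsub>E i\<^esub> \<in> carrier (E i) \<and> vnorm (E i) \<zero>\<^bsub>E i\<^esub> = 0"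
proof -
  assume i: "i \<in> {1..m}"
  interpret Ei: normed_space "E i" by (rule normed_space_E[OF i])
  show ?thesis by simp
qed

lemma origin_unit_balls: "origin \<in> unit_balls m E"
  using zero_E_closed by (auto simp: origin_def unit_balls_def)

text \<open>The product topology is not defined by a norm; this lemma extracts one radius for all
  coordinates, which exists because there are finitely many.\<close>

lemma neighbourhood_of_origin:
  assumes U: "openin X U" "origin \<in> U"
  shows "\<exists>\<delta>>0. \<forall>y\<in>T. (\<forall>i\<in>{1..m}. vnorm (E i) (y i) < \<delta>) \<longrightarrow> y \<in> U"
proof -
  obtain V where V: "\<And>i. i \<in> {1..m} \<Longrightarrow> openin (norm_topology (E i)) (V i)"
      "origin \<in> Pi\<^sub>E {1..m} V" "Pi\<^sub>E {1..m} V \<subseteq> U"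
    using U(1)[unfolded openin_product_topology_alt, rule_format, OF U(2)] by blast
  have "\<exists>d>0. \<forall>u\<in>carrier (E i). vnorm (E i) u < d \<longrightarrow> u \<in> V i" if i: "i \<in> {1..m}" for i
  proof -
    interpret Ei: normed_space "E i" by (rule normed_space_E[OF i])
    interpret Metric_space "carrier (E i)" "vdist (E i)" by (rule Ei.Metric_space_vdist)
    have "\<zero>\<^bsub>E i\<^esub> \<in> V i"
      using V(2) i by (auto simp: origin_def PiE_iff)
    then obtain d where d: "d > 0" "mball \<zero>\<^bsub>E i\<^esub> d \<subseteq> V i"
      using V(1)[OF i] unfolding norm_topology_def openin_mtopology by blast
    have "u \<in> mball \<zero>\<^bsub>E i\<^esub> d" if u: "u \<in> carrier (E i)" "vnorm (E i) u < d" for u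
      using u by (simp add: vdist_def Ei.M.minus_eq Ei.vnorm_minus)
    with d show ?thesis
      by blast
  qed
  then obtain d where d: "\<And>i. i \<in> {1..m} \<Longrightarrow> d i > 0"
      "\<And>i u. i \<in> {1..m} \<Longrightarrow> u \<in> carrier (E i) \<Longrightarrow> vnorm (E i) u < d i \<Longrightarrow> u \<in> V i"
    by metis
  (* The 1 keeps the minimum meaningful when there are no coordinates. *)
  define \<delta> where "\<delta> = Min (insert 1 (d ` {1..m}))"
  have "\<delta> > 0"
    unfolding \<delta>_def using d(1) by (subst Min_gr_iff) auto
  moreover have \<delta>_le: "\<delta> \<le> d i" if "i \<in> {1..m}" for i
    unfolding \<delta>_def using that by (intro Min_le) auto
  have "y \<in> U" if y: "y \<in> T" "\<forall>i\<in>{1..m}. vnorm (E i) (y i) < \<delta>" for y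
  proof -
    have "y i \<in> V i" if i: "i \<in> {1..m}" for i
      using d(2)[OF i tuples_nth[OF y(1) i]] bspec[OF y(2) i] \<delta>_le[OF i] by simp
    then have "y \<in> Pi\<^sub>E {1..m} V"
      using y(1) by (auto simp: tuples_def PiE_iff)
    with V(3) show ?thesis
      by blast
  qed
  ultimately show ?thesis
    by blast
qed

text \<open>By continuity at the origin, where \<open>A\<close> vanishes, some \<open>\<delta>\<close> has \<open>\<parallel>A y\<parallel> < 1\<close> as soon as all
  coordinates of \<open>y\<close> have norm below \<open>\<delta>\<close>. Shrinking the coordinates of a tuple of the unit balls
  by \<open>\<delta>/2\<close> brings it there and multiplies the value of \<open>A\<close> by \<open>(\<delta>/2)\<^sup>m\<close>. For \<open>m = 0\<close> an operator
  need not vanish at the only tuple, but then there is just one value.\<close>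

lemma bdd_above_unit_balls:
  assumes A: "A \<in> carrier L"
  shows "bdd_above ((\<lambda>x. vnorm F (A x)) ` unit_balls m E)"
proof (cases "m = 0")
  case True
  then show ?thesis
    by (simp add: unit_balls_def)
next
  case False
  interpret DF: Metric_space "carrier F" "vdist F" by (rule F.Metric_space_vdist)
  have mA: "multilinear m E F A" and cont: "continuous_map X (norm_topology F) A"
    using A by (auto simp: cont_multilinear_def)
  have oT: "origin \<in> T"
    using origin_unit_balls by (rule unit_balls_tuples)
  have A0: "A origin = \<zero>\<^bsub>F\<^esub>"
    using False zero_E_closed by (intro multilinear_eq_zero[OF mA oT, of 1]) (auto simp: origin_def)
  define U where "U = {y \<in> topspace X. A y \<in> DF.mball \<zero>\<^bsub>F\<^esub> 1}"
  have "openin X U"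
    unfolding U_def by (rule openin_continuous_map_preimage[OF cont])
      (auto simp: norm_topology_def)
  moreover have "origin \<in> U"
    unfolding U_def topspace_X using oT A0 by simp
  ultimately obtain \<delta> where \<delta>: "\<delta> > 0"
      "\<And>y. y \<in> T \<Longrightarrow> \<forall>i\<in>{1..m}. vnorm (E i) (y i) < \<delta> \<Longrightarrow> y \<in> U"
    using neighbourhood_of_origin by metis
  define c :: 'k where "c = of_real (\<delta> / 2)"
  have nc: "norm c = \<delta> / 2"
    using \<delta>(1) by (simp add: c_def)
  have "vnorm F (A x) \<le> 1 / (\<delta> / 2) ^ m" if x: "x \<in> unit_balls m E" for x
  proof -
    let ?y = "\<lambda>i. if i \<in> {1..m} then c \<odot>\<^bsub>E i\<^esub> x i else x i"
    have xT: "x \<in> T"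
      using x by (rule unit_balls_tuples)
    have y: "?y \<in> T" "A ?y = (\<Prod>i\<in>{1..m}. c) \<odot>\<^bsub>F\<^esub> A x"
      using multilinear_scale[OF mA xT subset_refl, of "\<lambda>_. c"] by auto
    have "vnorm (E i) (?y i) < \<delta>" if i: "i \<in> {1..m}" for i
    proof -
      have "vnorm (E i) (?y i) = norm c * vnorm (E i) (x i)"
        using normed_space.vnorm_smult[OF normed_space_E[OF i] tuples_nth[OF xT i]] i by simp
      also have "\<dots> \<le> norm c * 1"
        using x i by (intro mult_left_mono) (auto simp: unit_balls_def)
      finally show ?thesis
        using nc \<delta>(1) by simp
    qed
    then have "?y \<in> U"
      by (intro \<delta>(2) y(1)) blast
    then have "vdist F \<zero>\<^bsub>F\<^esub> (A ?y) < 1"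
      by (simp add: U_def)
    moreover have "vdist F \<zero>\<^bsub>F\<^esub> (A ?y) = vnorm F (A ?y)"
      using multilinear_closed[OF mA y(1)] by (simp add: vdist_def F.M.minus_eq F.vnorm_minus)
    ultimately have "vnorm F (A ?y) < 1"
      by simp
    then have "(\<delta> / 2) ^ m * vnorm F (A x) < 1"
      unfolding y(2) using F.vnorm_smult[OF multilinear_closed[OF mA xT]] nc
      by (simp add: norm_power)
    then show ?thesis
      using \<delta>(1) by (simp add: pos_le_divide_eq mult.commute)
  qed
  then show ?thesis
    by (auto simp: bdd_above_def)
qed

lemma vnorm_L: "vnorm L A = (SUP x\<in>unit_balls m E. vnorm F (A x))"
  by (simp add: cont_multilinear_def)

lemma vnorm_le_vnorm_L:
  "A \<in> carrier L \<Longrightarrow> x \<in> unit_balls m E \<Longrightarrow> vnorm F (A x) \<le> vnorm L A"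
  unfolding vnorm_L by (rule cSUP_upper[OF _ bdd_above_unit_balls])

lemma vnorm_L_leI: "(\<And>x. x \<in> unit_balls m E \<Longrightarrow> vnorm F (A x) \<le> b) \<Longrightarrow> vnorm L A \<le> b"
  unfolding vnorm_L using origin_unit_balls by (intro cSUP_least) auto

lemma vnorm_L_nonneg: "A \<in> carrier L \<Longrightarrow> 0 \<le> vnorm L A"
  using vnorm_le_vnorm_L[OF _ origin_unit_balls] F.vnorm_nonneg carrier_closed
    unit_balls_tuples[OF origin_unit_balls] by (meson order_trans)

text \<open>Normalising every coordinate of \<open>x\<close> yields a tuple of the unit balls, where the supremum
  bounds the value, and scaling back produces the product of the norms.\<close>

lemma operator_bound:
  assumes A: "A \<in> carrier L" and x: "x \<in> T"
  shows "vnorm F (A x) \<le> vnorm L A * (\<Prod>i=1..m. vnorm (E i) (x i))"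
proof (cases "\<exists>i\<in>{1..m}. vnorm (E i) (x i) = 0")
  case True
  have mA: "multilinear m E F A"
    using A by (simp add: carrier_L_iff)
  from True have "(\<Prod>i=1..m. vnorm (E i) (x i)) = 0"
    by (intro prod_zero) auto
  moreover have "A x = \<zero>\<^bsub>F\<^esub>"
    using True multilinear_eq_zero[OF mA x] by blast
  ultimately show ?thesis
    by (simp only: F.vnorm_zero)
next
  case False
  have mA: "multilinear m E F A"
    using A by (simp add: carrier_L_iff)
  have pos: "vnorm (E i) (x i) > 0" if i: "i \<in> {1..m}" for i
    using normed_space.vnorm_nonneg[OF normed_space_E[OF i] tuples_nth[OF x i]] False i
    by (metis order_le_less)
  define c :: "nat \<Rightarrow> 'k" where "c i = of_real (inverse (vnorm (E i) (x i)))" for i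
  have nc: "norm (c i) = inverse (vnorm (E i) (x i))" if "i \<in> {1..m}" for i
    using pos[OF that] by (simp add: c_def norm_inverse)
  let ?y = "\<lambda>i. if i \<in> {1..m} then c i \<odot>\<^bsub>E i\<^esub> x i else x i"
  have y: "?y \<in> T" "A ?y = (\<Prod>i\<in>{1..m}. c i) \<odot>\<^bsub>F\<^esub> A x"
    using multilinear_scale[OF mA x subset_refl, of c] by auto
  have "vnorm (E i) (?y i) \<le> 1" if i: "i \<in> {1..m}" for i
    using normed_space.vnorm_smult[OF normed_space_E[OF i] tuples_nth[OF x i]] i nc[OF i] pos[OF i]
    by simp
  then have "?y \<in> unit_balls m E"
    using y(1) by (auto simp: unit_balls_def tuples_def PiE_iff)
  then have "vnorm F (A ?y) \<le> vnorm L A"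
    by (rule vnorm_le_vnorm_L[OF A])
  moreover have "vnorm F (A ?y) = inverse (\<Prod>i=1..m. vnorm (E i) (x i)) * vnorm F (A x)"
    unfolding y(2) using F.vnorm_smult[OF multilinear_closed[OF mA x]]
    by (simp add: prod_norm[symmetric] nc prod_inversef[symmetric])
  moreover have "(\<Prod>i=1..m. vnorm (E i) (x i)) > 0"
    using pos by (intro prod_pos) auto
  ultimately show ?thesis
    by (simp add: field_simps)
qed

lemma normed_space_L: "normed_space L"
proof (rule normed_space.intro[OF module_L], rule normed_space_axioms.intro)
  note [simp] = add_L_closed smult_L_closed zero_L_closed carrier_closed L_simps
    unit_balls_tuples
  fix A
  assume A: "A \<in> carrier L"
  show "0 \<le> vnorm L A"
    using A by (rule vnorm_L_nonneg)
  show "vnorm L A = 0 \<longleftrightarrow> A = \<zero>\<^bsub>L\<^esub>"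
  proof
    assume 0: "vnorm L A = 0"
    have "A x = \<zero>\<^bsub>F\<^esub>" if x: "x \<in> T" for x
      using operator_bound[OF A x] 0 F.vnorm_nonneg[of "A x"] F.vnorm_eq_0[of "A x"] A x by simp
    then show "A = \<zero>\<^bsub>L\<^esub>"
      using A by (intro L_eqI) (auto simp: L_extensional)
  next
    assume "A = \<zero>\<^bsub>L\<^esub>"
    then show "vnorm L A = 0"
      using vnorm_L_leI[of A 0] vnorm_L_nonneg[OF A] by simp
  qed
  have le: "vnorm L (c \<odot>\<^bsub>L\<^esub> B) \<le> norm c * vnorm L B" if B: "B \<in> carrier L" for c B
    using B by (intro vnorm_L_leI)
      (auto simp: F.vnorm_smult intro!: mult_left_mono vnorm_le_vnorm_L)
  (* The reverse inequality is the same one for the scalar inverse c and the operator c A. *)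
  show "vnorm L (c \<odot>\<^bsub>L\<^esub> A) = norm c * vnorm L A" for c
  proof (rule antisym)
    show "vnorm L (c \<odot>\<^bsub>L\<^esub> A) \<le> norm c * vnorm L A"
      using A by (rule le)
    show "norm c * vnorm L A \<le> vnorm L (c \<odot>\<^bsub>L\<^esub> A)"
    proof (cases "c = 0")
      case True
      then show ?thesis
        using A by (simp add: vnorm_L_nonneg)
    next
      case False
      have "inverse c \<odot>\<^bsub>L\<^esub> (c \<odot>\<^bsub>L\<^esub> A) = A"
        using module.smult_assoc1[OF module_L, of "inverse c" c A]
          module.smult_one[OF module_L A] A False by simp
      then have "vnorm L A \<le> norm (inverse c) * vnorm L (c \<odot>\<^bsub>L\<^esub> A)"
        using le[of "c \<odot>\<^bsub>L\<^esub> A" "inverse c"] A by simp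
      then show ?thesis
        using False unfolding norm_inverse by (simp add: field_simps)
    qed
  qed
  show "vnorm L (A \<oplus>\<^bsub>L\<^esub> B) \<le> vnorm L A + vnorm L B" if B: "B \<in> carrier L" for B
  proof (rule vnorm_L_leI)
    fix x
    assume x: "x \<in> unit_balls m E"
    show "vnorm F ((A \<oplus>\<^bsub>L\<^esub> B) x) \<le> vnorm L A + vnorm L B"
      using F.vnorm_triangle[of "A x" "B x"] vnorm_le_vnorm_L[OF A x] vnorm_le_vnorm_L[OF B x]
        A B x by simp
  qed
qed

sublocale L: normed_space L
  by (rule normed_space_L)

lemma L_diff: "A \<in> carrier L \<Longrightarrow> B \<in> carrier L \<Longrightarrow> x \<in> T \<Longrightarrow> (A \<ominus>\<^bsub>L\<^esub> B) x = A x \<ominus>\<^bsub>F\<^esub> B x"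
  by (simp add: L.M.minus_eq L.minus_conv_smult F.M.minus_eq F.minus_conv_smult L_simps
      carrier_closed)

section \<open>Operators that preserve given limits\<close>

definition preserving :: "((nat \<Rightarrow> nat \<Rightarrow> 'a) \<times> (nat \<Rightarrow> 'a)) set \<Rightarrow> ((nat \<Rightarrow> 'a) \<Rightarrow> 'b) set" where
  "preserving R = {A \<in> carrier L.
     \<forall>xs x. xs \<in> m_bounded_seqs m E \<and> (xs, x) \<in> R \<longrightarrow>
       limitin (norm_topology F) (\<lambda>n. A (xs n)) (A x) sequentially}"

lemma m_bounded_seqs_tuples: "xs \<in> m_bounded_seqs m E \<Longrightarrow> xs n \<in> T"
  by (simp add: m_bounded_seqs_def)

lemma submodule_preserving:
  assumes R: "R \<subseteq> m_bounded_seqs m E \<times> T"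
  shows "submodule (preserving R) scalars L"
proof (rule L.submoduleI)
  note [simp] = m_bounded_seqs_tuples L_simps
  have RT: "x \<in> T" if "(xs, x) \<in> R" for xs x
    using R that by auto
  have smult: "c \<odot>\<^bsub>L\<^esub> A \<in> preserving R" if "A \<in> preserving R" for c A
    using that by (auto simp: preserving_def smult_L_closed RT intro!: F.limitin_smult)
  then show "c \<odot>\<^bsub>L\<^esub> A \<in> preserving R" if "A \<in> preserving R" for c A
    using that .
  show "\<ominus>\<^bsub>L\<^esub> A \<in> preserving R" if "A \<in> preserving R" for A
    using smult[OF that, of "-1"] that by (simp add: L.minus_conv_smult preserving_def)
  show "A \<oplus>\<^bsub>L\<^esub> B \<in> preserving R" if "A \<in> preserving R" "B \<in> preserving R" for A B
    using that by (auto simp: preserving_def add_L_closed RT intro!: F.limitin_add)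
  show "\<zero>\<^bsub>L\<^esub> \<in> preserving R"
    by (auto simp: preserving_def zero_L_closed RT F.limitin_const_norm_topology)
qed (auto simp: preserving_def)

text \<open>The triangle inequality along \<open>A x, B x, B y, A y\<close>; \<open>operator_bound\<close> for the difference
  of \<open>A\<close> and \<open>B\<close> controls the first and last steps.\<close>

lemma vnorm_diff_le:
  assumes A: "A \<in> carrier L" and B: "B \<in> carrier L" and x: "x \<in> T" and y: "y \<in> T"
    and Kx: "(\<Prod>i=1..m. vnorm (E i) (x i)) \<le> K" and Ky: "(\<Prod>i=1..m. vnorm (E i) (y i)) \<le> K"
  shows "vnorm F (A x \<ominus>\<^bsub>F\<^esub> A y) \<le> 2 * (vnorm L (A \<ominus>\<^bsub>L\<^esub> B) * K) + vnorm F (B x \<ominus>\<^bsub>F\<^esub> B y)"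
proof -
  let ?D = "A \<ominus>\<^bsub>L\<^esub> B"
  have D: "?D \<in> carrier L"
    using A B by simp
  have bound: "vnorm F (?D z) \<le> vnorm L ?D * K"
    if "z \<in> T" "(\<Prod>i=1..m. vnorm (E i) (z i)) \<le> K" for z
    using operator_bound[OF D that(1)] mult_left_mono[OF that(2) vnorm_L_nonneg[OF D]] by linarith
  have cl: "A x \<in> carrier F" "A y \<in> carrier F" "B x \<in> carrier F" "B y \<in> carrier F"
    using A B x y by (simp_all add: carrier_closed)
  interpret DF: Metric_space "carrier F" "vdist F" by (rule F.Metric_space_vdist)
  have "vdist F (A x) (A y) \<le> vdist F (A x) (B x) + vdist F (B x) (B y) + vdist F (A y) (B y)"
    using DF.triangle[of "A x" "B x" "A y"] DF.triangle[of "B x" "B y" "A y"]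
      DF.commute[of "A y" "B y"] cl by linarith
  then show ?thesis
    using bound[OF x Kx] bound[OF y Ky] cl A B x y by (simp add: vdist_def L_diff)
qed

lemma closedin_preserving:
  assumes R: "R \<subseteq> m_bounded_seqs m E \<times> T"
  shows "closedin (norm_topology L) (preserving R)"
proof -
  interpret DL: Metric_space "carrier L" "vdist L" by (rule L.Metric_space_vdist)
  have "A \<in> preserving R"
    if A: "A \<in> carrier L"
      and approx: "\<And>r. r > 0 \<Longrightarrow> \<exists>B\<in>preserving R. vnorm L (A \<ominus>\<^bsub>L\<^esub> B) < r" for A
    unfolding preserving_def
  proof (intro CollectI conjI allI impI A)
    fix xs x
    assume xsR: "xs \<in> m_bounded_seqs m E \<and> (xs, x) \<in> R"
    then have xsT: "xs n \<in> T" and x: "x \<in> T" for n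
      using R by (auto simp: m_bounded_seqs_tuples)
    obtain K0 where K0: "\<And>n. (\<Prod>i=1..m. vnorm (E i) (xs n i)) \<le> K0"
      using xsR by (auto simp: m_bounded_seqs_def bdd_above_def)
    (* The 1 makes K positive, so that the approximation error can be divided by it. *)
    define K where "K = max 1 (max K0 (\<Prod>i=1..m. vnorm (E i) (x i)))"
    have K: "(\<Prod>i=1..m. vnorm (E i) (xs n i)) \<le> K" "(\<Prod>i=1..m. vnorm (E i) (x i)) \<le> K"
        "K > 0" for n
      using K0[of n] by (auto simp: K_def)
    show "limitin (norm_topology F) (\<lambda>n. A (xs n)) (A x) sequentially"
      unfolding F.limitin_norm_topology
    proof (intro conjI allI impI)
      show "A x \<in> carrier F"
        using A x by (rule carrier_closed)
      fix \<epsilon> :: real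
      assume \<epsilon>: "\<epsilon> > 0"
      (* With this choice the two approximation errors add up to less than half of \<epsilon>. *)
      then obtain B where B: "B \<in> preserving R" "vnorm L (A \<ominus>\<^bsub>L\<^esub> B) < \<epsilon> / (4 * K)"
        using approx[of "\<epsilon> / (4 * K)"] K(3) by auto
      have BL: "B \<in> carrier L"
        using B(1) by (simp add: preserving_def)
      have "limitin (norm_topology F) (\<lambda>n. B (xs n)) (B x) sequentially"
        using B(1) xsR by (auto simp: preserving_def)
      then have "\<forall>\<^sub>F n in sequentially. B (xs n) \<in> carrier F \<and> vnorm F (B (xs n) \<ominus>\<^bsub>F\<^esub> B x) < \<epsilon> / 2"
        using F.limitin_norm_topologyD(2) half_gt_zero[OF \<epsilon>] by blast
      then show "\<forall>\<^sub>F n in sequentially. A (xs n) \<in> carrier F \<and> vnorm F (A (xs n) \<ominus>\<^bsub>F\<^esub> A x) < \<epsilon>"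
      proof eventually_elim
        case (elim n)
        have "vnorm F (A (xs n) \<ominus>\<^bsub>F\<^esub> A x)
            \<le> 2 * (vnorm L (A \<ominus>\<^bsub>L\<^esub> B) * K) + vnorm F (B (xs n) \<ominus>\<^bsub>F\<^esub> B x)"
          by (rule vnorm_diff_le[OF A BL xsT x K(1,2)])
        moreover have "vnorm L (A \<ominus>\<^bsub>L\<^esub> B) * K < \<epsilon> / 4"
          using B(2) K(3) by (simp add: field_simps)
        ultimately show ?case
          using elim carrier_closed[OF A xsT] by simp
      qed
    qed
  qed
  then have "\<exists>r>0. disjnt (preserving R) (DL.mball A r)" if "A \<in> carrier L - preserving R" for A
    using that unfolding disjnt_iff
    by (simp add: vdist_def) (metis (no_types, lifting) not_less_iff_gr_or_eq)
  then show ?thesis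
    unfolding norm_topology_def DL.closedin_metric by (auto simp: preserving_def)
qed

end

theorem proposition4p3:
  fixes m :: nat
    and E :: "nat \<Rightarrow> ('k::real_normed_field, 'a) normed_space"
    and F :: "('k, 'b) normed_space"
    and R :: "((nat \<Rightarrow> nat \<Rightarrow> 'a) \<times> (nat \<Rightarrow> 'a)) set"
  assumes "1 \<le> m"
    and "\<And>i. i \<in> {1..m} \<Longrightarrow> banach_space (E i)"
    and "R \<subseteq> m_bounded_seqs m E \<times> tuples m E"
    and "banach_space F"
  shows "closed_subspace
           {A \<in> carrier (cont_multilinear m E F).
              \<forall>xs x. xs \<in> m_bounded_seqs m E \<and> (xs, x) \<in> R \<longrightarrow>
                limitin (norm_topology F) (\<lambda>n. A (xs n)) (A x) sequentially}
           (cont_multilinear m E F)"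
proof -
  interpret multilinear_spaces m E F
    by (intro multilinear_spaces.intro banach_space.axioms(1) assms(2,4))
  show ?thesis
    using submodule_preserving[OF assms(3)] closedin_preserving[OF assms(3)]
    by (simp add: closed_subspace_def preserving_def)
qed

end
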